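(* Let $p\in\mathbb{Z}_{\ge2}$, let $m_1\le m_2$ be two integers and let $r_1$ (resp. $r_2$) be the remainder of $m_1$ (resp. $m_2$) divided by $p$. The following are equivalent: (1) $m_2-m_1<p-1$ and $0<r_1\le r_2$. (2) There is no multiple of $p$ between $m_1$ and $m_2$, i.e. there is no $a\in\mathbb{Z}$ with $m_1\le ap\le m_2$.
   Context: Remainders are taken in $\{0,1,\ldots,p-1\}$. *)

theory Defs
  imports Main
begin

end

theory Submission
  imports Defs
begin

text \<open>
  The multiples of \<^term>\<open>p\<close> cut the integers into blocks of length \<^term>\<open>p\<close>, and the quotient
  \<^term>\<open>m div p\<close> names the block that contains \<^term>\<open>m\<close>.  Only the left end of a block is a
  multiple of \<^term>\<open>p\<close>.  Hence no multiple lies between \<^term>\<open>m1\<close> and \<^term>\<open>m2\<close> exactly when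
  both lie in the same block and \<^term>\<open>m1\<close> is not its left end (\<open>no_multiple_between_iff\<close>).
  The bound on \<^term>\<open>m2 - m1\<close> together with the order of the remainders is an equivalent way
  of saying that the two quotients agree, once the remainder of \<^term>\<open>m1\<close> is positive
  (\<open>same_quotient_iff\<close>).
\<close>

text \<open>
  The multiple that decides the matter is the first one that is at least \<^term>\<open>m1\<close>: it is
  \<^term>\<open>m1\<close> itself if the remainder vanishes, and the left end of the next block otherwise.
\<close>

lemma no_multiple_between_iff:
  fixes p m1 m2 :: int
  assumes "0 < p" and "m1 \<le> m2"
  shows "\<not> (\<exists>a. m1 \<le> a * p \<and> a * p \<le> m2) \<longleftrightarrow> 0 < m1 mod p \<and> m1 div p = m2 div p"
proof
  assume none: "\<not> (\<exists>a. m1 \<le> a * p \<and> a * p \<le> m2)"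
  have "m1 mod p \<noteq> 0"
  proof
    assume "m1 mod p = 0"
    then have "m1 = (m1 div p) * p"
      using div_mult_mod_eq[of m1 p] by simp
    then show False
      using none \<open>m1 \<le> m2\<close> by (metis order_refl)
  qed
  then have pos: "0 < m1 mod p"
    using pos_mod_sign[OF \<open>0 < p\<close>, of m1] by linarith
  have "m1 \<le> (m1 div p + 1) * p"
    using div_mult_mod_eq[of m1 p] pos_mod_bound[OF \<open>0 < p\<close>, of m1]
    unfolding distrib_right by linarith
  then have "m2 < (m1 div p + 1) * p"
    using none by (meson not_le)
  then have "(m2 div p) * p < (m1 div p + 1) * p"
    using div_mult_mod_eq[of m2 p] pos_mod_sign[OF \<open>0 < p\<close>, of m2] by linarith
  then have "m2 div p < m1 div p + 1"
    using \<open>0 < p\<close> by simp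
  moreover have "m1 div p \<le> m2 div p"
    using assms by (simp add: zdiv_mono1)
  ultimately show "0 < m1 mod p \<and> m1 div p = m2 div p"
    using pos by simp
next
  assume same: "0 < m1 mod p \<and> m1 div p = m2 div p"
  show "\<not> (\<exists>a. m1 \<le> a * p \<and> a * p \<le> m2)"
  proof
    assume "\<exists>a. m1 \<le> a * p \<and> a * p \<le> m2"
    then obtain a where a: "m1 \<le> a * p" "a * p \<le> m2" by blast
    have "(m1 div p) * p < a * p"
      using a(1) same div_mult_mod_eq[of m1 p] by linarith
    then have "m1 div p < a"
      using \<open>0 < p\<close> by simp
    moreover have "a \<le> m2 div p"
      using zdiv_mono1[OF a(2) \<open>0 < p\<close>] \<open>0 < p\<close> by simp
    ultimately show False
      using same by simp
  qed
qed

text \<open>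
  With equal quotients the difference of the numbers is the difference of the remainders, which
  is at most \<^term>\<open>p - 2\<close> because the smaller remainder is at least 1 and the larger at most
  \<^term>\<open>p - 1\<close>.  Conversely, if the remainders do not decrease, each step to a further block
  costs at least \<^term>\<open>p\<close>, more than the bound allows.
\<close>

lemma same_quotient_iff:
  fixes p m1 m2 :: int
  assumes "0 < p" and "m1 \<le> m2" and "0 < m1 mod p"
  shows "m1 div p = m2 div p \<longleftrightarrow> m2 - m1 < p - 1 \<and> m1 mod p \<le> m2 mod p"
proof
  assume "m1 div p = m2 div p"
  then have "m2 - m1 = m2 mod p - m1 mod p"
    using div_mult_mod_eq[of m1 p] div_mult_mod_eq[of m2 p] by (metis add_diff_cancel_left)
  then show "m2 - m1 < p - 1 \<and> m1 mod p \<le> m2 mod p"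
    using assms pos_mod_bound[OF \<open>0 < p\<close>, of m2] by linarith
next
  assume close: "m2 - m1 < p - 1 \<and> m1 mod p \<le> m2 mod p"
  have "(m2 div p) * p < (m1 div p + 1) * p"
    using close div_mult_mod_eq[of m1 p] div_mult_mod_eq[of m2 p]
    unfolding distrib_right by linarith
  then have "m2 div p < m1 div p + 1"
    using \<open>0 < p\<close> by simp
  moreover have "m1 div p \<le> m2 div p"
    using assms by (simp add: zdiv_mono1)
  ultimately show "m1 div p = m2 div p"
    by simp
qed

theorem lemma4p1:
  fixes p m1 m2 r1 r2 :: int
  assumes "p \<ge> 2"
    and "m1 \<le> m2"
    and "r1 = m1 mod p"
    and "r2 = m2 mod p"
  shows "(m2 - m1 < p - 1 \<and> 0 < r1 \<and> r1 \<le> r2) \<longleftrightarrow>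
         \<not> (\<exists>a::int. m1 \<le> a * p \<and> a * p \<le> m2)"
proof -
  have "0 < p"
    using \<open>p \<ge> 2\<close> by simp
  show ?thesis
    unfolding no_multiple_between_iff[OF \<open>0 < p\<close> \<open>m1 \<le> m2\<close>] assms(3,4)
    using same_quotient_iff[OF \<open>0 < p\<close> \<open>m1 \<le> m2\<close>] by blast
qed

end
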